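(* Let $m,p$ be integers with $m$ even and $0<m\leq p$. Then the following two statements are equivalent: 1. For every involution $R\in SO(p)$ of level $m$, there exists $\sigma\in\mathcal{I}_p^+$ of level $m$ such that $d_{SO}(RI_\sigma,I)<d_{SO}(R,I)$ (i.e. every involution of level $m$ is sign-change reducible by a sign-change of level $m$). 2. For every $W\in\mathrm{Gr}_m(\mathbf{R}^p)$, there exists a coordinate $m$-plane $\mathbf{R}^J$ such that $$d_{Gr}(W,\mathbf{R}^J)^2<\frac{m\pi^2}{8}.$$
   Context: $SO(p)$ carries the bi-invariant Riemannian metric given at the identity by $g_{SO}(A_1,A_2)=-\frac12\mathrm{tr}(A_1A_2)$, with geodesic distance $d_{SO}$; thus $d_{SO}(U,V)=\min\{\frac{1}{\sqrt2}\|A\|_F : A\in\mathfrak{so}(p),\ \exp(A)=U^{-1}V\}$. An involution is an $R\in SO(p)$ with $R^2=I\ne R$; its level is the dimension of its $(-1)$-eigenspace. $\mathcal{I}_p^+=\{\sigma\in\{\pm1\}^p:\prod_i\sigma_i=1\}$, $I_\sigma=\mathrm{diag}(\sigma_1,\dots,\sigma_p)$, and the level of $\sigma$ is $\#\{i:\sigma_i=-1\}$. $\mathrm{Gr}_m(\mathbf{R}^p)$ is the Grassmannian of $m$-dimensional subspaces of $\mathbf{R}^p$. For an $m$-element subset $J\subset\{1,\dots,p\}$, the coordinate $m$-plane $\mathbf{R}^J$ is $\{(x^1,\dots,x^p)\in\mathbf{R}^p:x^i=0\text{ if }i\notin J\}$. $d_{Gr}(W,Z)=\left(\sum_{i=1}^m\phi_i(W,Z)^2\right)^{1/2}$,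 where $\phi_i(W,Z)\in[0,\pi/2]$ are the principal angles between $W$ and $Z$ (arccosines of the singular values of $\tilde W^T\tilde Z$, the columns of $\tilde W,\tilde Z$ being orthonormal bases of $W,Z$). *)

theory Defs
  imports "HOL-Analysis.Analysis"
begin

definition diag_mat :: "('n \<Rightarrow> real) \<Rightarrow> real^'n^'n" where
  "diag_mat s = (\<chi> i j. if i = j then s i else 0)"


section \<open>The special orthogonal group\<close>

text \<open>On the type \<open>real^'n^'n\<close> the library's multiplication is entrywise, so neither
  \<open>(^)\<close> nor \<open>exp\<close> is the matrix notion.\<close>

primrec mat_power :: "real^'n^'n \<Rightarrow> nat \<Rightarrow> real^'n^'n" where
  "mat_power A 0 = mat 1"
| "mat_power A (Suc k) = A ** mat_power A k"

definition mat_exp :: "real^'n^'n \<Rightarrow> real^'n^'n" where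
  "mat_exp A = (\<Sum>k. (1 / fact k) *\<^sub>R mat_power A k)"

definition SO :: "(real^'n^'n) set" where
  "SO = {U. orthogonal_matrix U \<and> det U = 1}"

definition so_algebra :: "(real^'n^'n) set" where
  "so_algebra = {A. transpose A = - A}"

text \<open>The library norm on \<open>real^'n^'n\<close> is the Frobenius norm. The formula is that of the geodesic
  distance of the bi-invariant metric on \<open>SO\<close> given by \<open>- trace (A ** B) / 2\<close> at the
  identity. For \<open>U, V \<in> SO\<close> the set is nonempty and the infimum is a minimum.\<close>

definition d_SO :: "real^'n^'n \<Rightarrow> real^'n^'n \<Rightarrow> real" where
  "d_SO U V = Inf {1 / sqrt 2 * norm A | A. A \<in> so_algebra \<and> mat_exp A = matrix_inv U ** V}"

definition involution :: "real^'n^'n \<Rightarrow> bool" where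
  "involution R \<longleftrightarrow> R \<in> SO \<and> R ** R = mat 1 \<and> R \<noteq> mat 1"

definition involution_level :: "real^'n^'n \<Rightarrow> nat" where
  "involution_level R = dim {x. R *v x = - x}"

definition even_sign_changes :: "('n::finite \<Rightarrow> real) set" where
  "even_sign_changes = {\<sigma>. (\<forall>i. \<sigma> i \<in> {1, -1}) \<and> (\<Prod>i\<in>UNIV. \<sigma> i) = 1}"

definition sign_level :: "('n::finite \<Rightarrow> real) \<Rightarrow> nat" where
  "sign_level \<sigma> = card {i. \<sigma> i = -1}"


section \<open>The Grassmannian\<close>

definition Gr :: "nat \<Rightarrow> (real^'n) set set" where
  "Gr m = {W. subspace W \<and> dim W = m}"

definition coord_plane :: "'n set \<Rightarrow> (real^'n) set" where
  "coord_plane J = {x. \<forall>i. i \<notin> J \<longrightarrow> x $ i = 0}"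

text \<open>The columns of the \<open>n \<times> m\<close> matrix \<open>B\<close> form an orthonormal basis of \<open>W\<close>.\<close>

definition orthonormal_basis_matrix :: "real^'m^'n \<Rightarrow> (real^'n) set \<Rightarrow> bool" where
  "orthonormal_basis_matrix B W \<longleftrightarrow> transpose B ** B = mat 1 \<and> span (columns B) = W"

text \<open>The diagonal of a singular value decomposition, which is unique up to reordering.\<close>

definition is_singular_values :: "real^'m^'m \<Rightarrow> ('m \<Rightarrow> real) \<Rightarrow> bool" where
  "is_singular_values A s \<longleftrightarrow> (\<forall>i. 0 \<le> s i) \<and>
     (\<exists>U V. orthogonal_matrix U \<and> orthogonal_matrix V \<and> A = U ** diag_mat s ** transpose V)"

definition singular_values :: "real^'m^'m \<Rightarrow> 'm \<Rightarrow> real" where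
  "singular_values A = (SOME s. is_singular_values A s)"

text \<open>The dimension of the two subspaces is the cardinality of the index type \<open>'m\<close>, passed as
  the first argument. Other choices of the orthonormal bases only permute the angles, which
  does not affect \<open>d_Gr\<close>.\<close>

definition principal_angle :: "'m itself \<Rightarrow> (real^'n) set \<Rightarrow> (real^'n) set \<Rightarrow> 'm::finite \<Rightarrow> real" where
  "principal_angle T W Z i =
     (let W' = (SOME B :: real^'m^'n. orthonormal_basis_matrix B W);
          Z' = (SOME B :: real^'m^'n. orthonormal_basis_matrix B Z)
      in arccos (singular_values (transpose W' ** Z') i))"

definition d_Gr :: "'m::finite itself \<Rightarrow> (real^'n) set \<Rightarrow> (real^'n) set \<Rightarrow> real" where
  "d_Gr T W Z = sqrt (\<Sum>i\<in>UNIV. (principal_angle T W Z i)\<^sup>2)"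

end

theory Submission
  imports Defs
begin

text \<open>
  An involution of level \<open>m\<close> is the reflection that negates an \<open>m\<close>-plane \<open>W\<close> and fixes its orthogonal
  complement, and each \<open>W\<close> arises in this way because \<open>m\<close> is even. A sign-change of level \<open>m\<close> is the
  reflection for a coordinate \<open>m\<close>-plane \<open>Z\<close>. The equivalence thus follows pair by pair from two
  distances, proved in \<open>d_SO_reflection\<close> and \<open>d_SO_product_of_reflections\<close>:
  a reflection \<open>R\<close> of level \<open>m\<close> has squared distance \<open>m * pi\<^sup>2 / 2\<close> from the identity, being a rotation by
  \<open>pi\<close> in \<open>m / 2\<close> orthogonal planes; and the product of the reflections for \<open>W\<close> and \<open>Z\<close> has distance
  \<open>2 * d_Gr W Z\<close> from the identity, being a rotation by twice the principal angle in each of the orthogonal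
  planes spanned by the pairs of principal vectors. So the product is closer to the identity than
  \<open>R\<close> if and only if \<open>4 * (d_Gr W Z)\<^sup>2 < m * pi\<^sup>2 / 2\<close>.

  Both distances are instances of \<open>d_SO_eq_rotation_angles\<close>: the distance of a rotation by angles
  \<open>t i \<in> {0..pi}\<close> in mutually orthogonal planes is the Euclidean norm of the angles. The upper
  bound is an explicit logarithm. The lower bound, \<open>skew_log_norm_minimal\<close>, says that no
  skew-symmetric logarithm is shorter than one with all speeds at most \<open>pi\<close>. It compares the
  eigenbases of the two logarithms through the symmetric part of the rotation, whose eigenvalues are the
  cosines of the speeds. Only real symmetric matrices have to be diagonalized for this; the same
  spectral theorem also yields the singular value decomposition behind the principal vectors.
\<close>

section \<open>Orthonormal families\<close>

lemma inner_matrix_vector_transpose: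
  fixes A :: "real^'n^'m"
  shows "(A *v x) \<bullet> y = x \<bullet> (transpose A *v y)"
  by (metis dot_lmul_matrix inner_commute transpose_matrix_vector)

definition orthonormal_on :: "'i set \<Rightarrow> ('i \<Rightarrow> 'a::real_inner) \<Rightarrow> bool" where
  "orthonormal_on I u \<longleftrightarrow> (\<forall>i\<in>I. \<forall>j\<in>I. u i \<bullet> u j = (if i = j then 1 else 0))"

lemma orthonormal_onD:
  "orthonormal_on I u \<Longrightarrow> i \<in> I \<Longrightarrow> j \<in> I \<Longrightarrow> u i \<bullet> u j = (if i = j then 1 else 0)"
  by (auto simp: orthonormal_on_def)

lemma orthonormal_family_of_subspace:
  fixes W :: "'a::euclidean_space set"
  assumes "subspace W" "finite I" "card I = dim W"
  obtains u where "orthonormal_on I u" "span (u ` I) = W"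
proof -
  obtain B where B: "pairwise orthogonal B" "\<And>x. x \<in> B \<Longrightarrow> norm x = 1"
      "independent B" "card B = dim W" "span B = W"
    using orthonormal_basis_subspace[OF assms(1)] by metis
  then obtain u where u: "bij_betw u I B"
    using assms independent_imp_finite bij_betw_iff_card by metis
  have "orthonormal_on I u"
    unfolding orthonormal_on_def
  proof (intro ballI)
    fix i j assume ij: "i \<in> I" "j \<in> I"
    then have "u i \<in> B" "u j \<in> B" "u i = u j \<longleftrightarrow> i = j"
      using u by (auto simp: bij_betw_def inj_on_def)
    then show "u i \<bullet> u j = (if i = j then 1 else 0)"
      using B(1) B(2)[of "u i"] by (auto simp: pairwise_def orthogonal_def norm_eq_1)
  qed
  moreover have "span (u ` I) = W"
    using u B by (simp add: bij_betw_def)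
  ultimately show ?thesis
    using that by blast
qed

lemma orthonormal_expansion:
  fixes u :: "'n::finite \<Rightarrow> real^'n"
  assumes "orthonormal_on UNIV u"
  shows "x = (\<Sum>i\<in>UNIV. (x \<bullet> u i) *\<^sub>R u i)"
proof -
  define U where "U = (\<chi> i. u i)"
  have "U ** transpose U = mat 1"
    using assms by (simp add: vec_eq_iff U_def matrix_matrix_mult_def mat_def transpose_def
        orthonormal_on_def inner_vec_def)
  then have "transpose U ** U = mat 1"
    by (simp add: matrix_left_right_inverse)
  then have "x = transpose U *v (U *v x)"
    by (simp add: matrix_vector_mul_assoc)
  also have "\<dots> = (\<Sum>i\<in>UNIV. (x \<bullet> u i) *\<^sub>R u i)"
    by (simp add: matrix_mult_sum column_def transpose_def U_def vec_eq_iff sum_distrib_left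
        matrix_vector_mult_def inner_vec_def mult.commute scalar_mult_eq_scaleR)
  finally show ?thesis .
qed

lemma orthonormal_parseval:
  fixes u :: "'n::finite \<Rightarrow> real^'n"
  assumes "orthonormal_on UNIV u"
  shows "x \<bullet> y = (\<Sum>i\<in>UNIV. (x \<bullet> u i) * (y \<bullet> u i))"
proof -
  have "x \<bullet> y = (\<Sum>i\<in>UNIV. (x \<bullet> u i) *\<^sub>R u i) \<bullet> y"
    using orthonormal_expansion[OF assms] by metis
  then show ?thesis
    by (simp add: inner_sum_left inner_commute[of y])
qed

text \<open>The Frobenius norm can be computed in any orthonormal basis of the domain: apply Parseval to
  each row of \<open>A\<close> and exchange the two sums.\<close>

lemma norm_matrix_square_orthonormal:
  fixes A :: "real^'n^'m" and u :: "'n \<Rightarrow> real^'n"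
  assumes "orthonormal_on UNIV u"
  shows "(norm A)\<^sup>2 = (\<Sum>j\<in>UNIV. (norm (A *v u j))\<^sup>2)"
proof -
  have "(norm A)\<^sup>2 = (\<Sum>i\<in>UNIV. A $ i \<bullet> A $ i)"
    by (simp add: power2_norm_eq_inner inner_vec_def)
  also have "\<dots> = (\<Sum>i\<in>UNIV. \<Sum>j\<in>UNIV. (A $ i \<bullet> u j) * (A $ i \<bullet> u j))"
    by (intro sum.cong refl orthonormal_parseval[OF assms])
  also have "\<dots> = (\<Sum>j\<in>UNIV. \<Sum>i\<in>UNIV. (A $ i \<bullet> u j) * (A $ i \<bullet> u j))"
    by (rule sum.swap)
  also have "\<dots> = (\<Sum>j\<in>UNIV. (norm (A *v u j))\<^sup>2)"
    by (simp add: power2_norm_eq_inner inner_vec_def matrix_vector_mult_def)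
  finally show ?thesis .
qed

section \<open>The spectral theorem for symmetric matrices\<close>

text \<open>A maximum point of the quadratic form \<open>x \<bullet> B x\<close> on the unit sphere of \<open>V\<close> is an eigenvector:
  its residual \<open>B x - (x \<bullet> B x) x\<close> is a tangent direction inside \<open>V\<close>, along which the form would
  grow to first order if the residual were nonzero.\<close>

lemma eigenvector_in_invariant_subspace:
  fixes B :: "real^'n^'n" and V :: "(real^'n) set"
  assumes sym: "transpose B = B" and V: "subspace V" "V \<noteq> {0}"
    and inv: "\<And>x. x \<in> V \<Longrightarrow> B *v x \<in> V"
  obtains x l where "x \<in> V" "norm x = 1" "B *v x = l *\<^sub>R x"
proof -
  let ?q = "\<lambda>x. x \<bullet> (B *v x)"
  let ?S = "V \<inter> sphere 0 1"
  have "compact ?S"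
    by (simp add: V(1) closed_subspace compact_Int closed_Int_compact)
  obtain v where v: "v \<in> V" "v \<noteq> 0"
    using V subspace_0 by blast
  then have "(1 / norm v) *\<^sub>R v \<in> ?S"
    using V(1) by (simp add: subspace_scale)
  then have "?S \<noteq> {}"
    by blast
  moreover have "continuous_on ?S ?q"
    by (intro continuous_intros linear_continuous_on matrix_vector_mul_bounded_linear)
  ultimately obtain x where x: "x \<in> ?S" and max: "\<And>y. y \<in> ?S \<Longrightarrow> ?q y \<le> ?q x"
    using continuous_attains_sup[OF \<open>compact ?S\<close>] by blast
  have nx: "x \<bullet> x = 1" and xV: "x \<in> V"
    using x by (auto simp: norm_eq_1)
  have bound: "?q y \<le> ?q x * (y \<bullet> y)" if "y \<in> V" for y
  proof (cases "y = 0")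
    case False
    then have "(1 / norm y) *\<^sub>R y \<in> ?S"
      using that V(1) by (simp add: subspace_scale)
    from max[OF this] have "?q y / (norm y)\<^sup>2 \<le> ?q x"
      by (simp add: matrix_vector_mult_scaleR power2_eq_square)
    then show ?thesis
      using False by (simp add: divide_le_eq power2_norm_eq_inner)
  qed simp
  define w where "w = B *v x - ?q x *\<^sub>R x"
  have wV: "w \<in> V"
    unfolding w_def using xV inv V(1) by (simp add: subspace_diff subspace_scale)
  have xw: "x \<bullet> w = 0"
    by (simp add: w_def inner_diff_right nx)
  have Bxw: "w \<bullet> (B *v x) = w \<bullet> w"
    by (simp add: w_def inner_diff_right inner_diff_left nx inner_commute algebra_simps)
  have sw: "x \<bullet> (B *v w) = w \<bullet> (B *v x)"
    using inner_matrix_vector_transpose[of B x w] sym by (simp add: inner_commute)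
  \<comment> \<open>first-order condition at the maximum, in the direction of the residual \<open>w\<close>\<close>
  have quad: "2 * t * (w \<bullet> w) \<le> t\<^sup>2 * (?q x * (w \<bullet> w) - ?q w)" for t
  proof -
    have "x + t *\<^sub>R w \<in> V"
      using xV wV V(1) by (simp add: subspace_add subspace_scale)
    from bound[OF this] show ?thesis
      using xw sw Bxw nx
      by (simp add: inner_add_left inner_add_right matrix_vector_right_distrib
          matrix_vector_mult_scaleR inner_commute[of w x] power2_eq_square algebra_simps)
  qed
  have "w \<bullet> w = 0"
  proof (rule ccontr)
    assume "w \<bullet> w \<noteq> 0"
    then have pos: "w \<bullet> w > 0"
      by (simp add: order.not_eq_order_implies_strict)
    define c where "c = \<bar>?q x * (w \<bullet> w) - ?q w\<bar> + 1"
    have c: "c > 0" "?q x * (w \<bullet> w) - ?q w \<le> c"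
      by (auto simp: c_def)
    have "2 * ((w \<bullet> w) / c) * (w \<bullet> w) \<le> ((w \<bullet> w) / c)\<^sup>2 * c"
      using quad[of "(w \<bullet> w) / c"] c(2) by (meson mult_left_mono order_trans zero_le_power2)
    also have "\<dots> = ((w \<bullet> w) / c) * (w \<bullet> w)"
      using c(1) by (simp add: power2_eq_square)
    finally have "(w \<bullet> w) * (w \<bullet> w) \<le> 0"
      using c(1) by (simp add: field_simps)
    then show False
      using pos by (meson mult_pos_pos not_less)
  qed
  then have "B *v x = ?q x *\<^sub>R x"
    by (simp add: w_def)
  moreover have "norm x = 1"
    using x by simp
  ultimately show ?thesis
    using that xV by blast
qed

text \<open>The orthogonal complement of a family of eigenvectors of a symmetric matrix is invariant, so it
  contains a further eigenvector as long as the family is not a basis. This one induction yields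
  both the spectral theorem (start from the empty family) and the extension of an orthonormal
  family to a basis (take \<open>B = 0\<close>, for which all vectors are eigenvectors).\<close>

lemma orthonormal_eigenfamily_extend:
  fixes B :: "real^'n^'n" and u :: "'n \<Rightarrow> real^'n"
  assumes sym: "transpose B = B" and on: "orthonormal_on I u"
    and eig: "\<And>i. i \<in> I \<Longrightarrow> B *v u i = l i *\<^sub>R u i"
  shows "\<exists>v k. orthonormal_on UNIV v \<and> (\<forall>i. B *v v i = k i *\<^sub>R v i) \<and> (\<forall>i\<in>I. v i = u i)"
  using on eig
proof (induction "card (- I)" arbitrary: I u l)
  case 0
  then have "I = UNIV"
    by auto
  then show ?case
    using 0 by (intro exI[of _ u] exI[of _ l]) auto
next
  case (Suc n)
  define V where "V = {x. \<forall>y\<in>u ` I. y \<bullet> x = 0}"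
  have "subspace V"
    unfolding V_def by (rule subspaceI) (auto simp: inner_add_right)
  have "I \<noteq> UNIV"
    using Suc(2) by auto
  then obtain j where j: "j \<notin> I"
    by auto
  have "dim (span (u ` I)) \<le> card (u ` I)"
    by (simp add: dim_le_card')
  also have "\<dots> \<le> card I"
    by (simp add: card_image_le)
  also have "\<dots> < CARD('n)"
    using \<open>I \<noteq> UNIV\<close> by (simp add: psubset_card_mono psubset_eq)
  finally have "span (u ` I) \<noteq> UNIV"
    by (metis dim_UNIV dim_span less_irrefl DIM_cart DIM_real mult.right_neutral)
  then obtain x where x: "x \<noteq> 0" "\<And>y. y \<in> span (u ` I) \<Longrightarrow> orthogonal x y"
    using orthogonal_to_subspace_exists_gen[of "u ` I" UNIV] by (auto simp: psubset_eq)
  then have "x \<in> V"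
    by (auto simp: V_def orthogonal_def inner_commute[of x] span_base)
  then have "V \<noteq> {0}"
    using x by auto
  have "B *v y \<in> V" if "y \<in> V" for y
    using that Suc(4) unfolding V_def
    by (auto simp: inner_matrix_vector_transpose[of B, unfolded sym, symmetric])
  with eigenvector_in_invariant_subspace[OF sym \<open>subspace V\<close> \<open>V \<noteq> {0}\<close>]
  obtain z k where z: "z \<in> V" "norm z = 1" "B *v z = k *\<^sub>R z"
    by metis
  have "orthonormal_on (insert j I) (u(j := z))"
    using Suc(3) z(1,2) j unfolding orthonormal_on_def V_def
    by (auto simp: norm_eq_1 inner_commute)
  moreover have "B *v (u(j := z)) i = (l(j := k)) i *\<^sub>R (u(j := z)) i" if "i \<in> insert j I" for i
    using that z(3) Suc(4) j by auto
  moreover have "n = card (- insert j I)"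
    using Suc(2) j by (metis Compl_iff Diff_insert_absorb card_Diff_singleton diff_Suc_1 finite
        Compl_insert card_Suc_Diff1 nat.inject)
  ultimately obtain v k where "orthonormal_on UNIV v" "\<forall>i. B *v v i = k i *\<^sub>R v i"
      "\<forall>i\<in>insert j I. v i = (u(j := z)) i"
    using Suc(1) by metis
  then show ?case
    using j by (intro exI[of _ v] exI[of _ k]) auto
qed

corollary symmetric_eigenbasis:
  fixes B :: "real^'n^'n"
  assumes "transpose B = B"
  obtains u :: "'n \<Rightarrow> real^'n" and k where "orthonormal_on UNIV u" "\<And>i. B *v u i = k i *\<^sub>R u i"
proof -
  have "orthonormal_on {} (\<lambda>_ :: 'n. 0 :: real^'n)"
    by (simp add: orthonormal_on_def)
  from orthonormal_eigenfamily_extend[OF assms this] show ?thesis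
    using that by auto
qed

corollary orthonormal_extend:
  fixes u :: "'n \<Rightarrow> real^'n"
  assumes "orthonormal_on I u"
  obtains v where "orthonormal_on UNIV v" "\<And>i. i \<in> I \<Longrightarrow> v i = u i"
proof -
  have "transpose (0 :: real^'n^'n) = 0"
    by (simp add: transpose_def vec_eq_iff)
  from orthonormal_eigenfamily_extend[OF this assms, of "\<lambda>_. 0"] show ?thesis
    using that by auto
qed

section \<open>The exponential of a skew-symmetric matrix\<close>

lemma norm_matrix_mult_le:
  fixes A :: "real^'n^'m" and B :: "real^'k^'n"
  shows "norm (A ** B) \<le> norm A * norm B"
proof -
  have rows: "(norm M)\<^sup>2 = (\<Sum>i\<in>UNIV. (norm (M $ i))\<^sup>2)" for M :: "real^'a^'b"
    by (simp add: power2_norm_eq_inner inner_vec_def)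
  have "(A ** B) $ i = transpose B *v (A $ i)" for i
    by (simp add: vec_eq_iff matrix_matrix_mult_def matrix_vector_mult_def transpose_def mult.commute)
  moreover have "norm (transpose B *v x) \<le> norm B * norm x" for x
  proof -
    have cs: "((transpose B *v x) $ j)\<^sup>2 \<le> (norm (transpose B $ j))\<^sup>2 * (norm x)\<^sup>2" for j
      using Cauchy_Schwarz_ineq[of "transpose B $ j" x]
      by (simp add: matrix_vector_mult_def inner_vec_def power2_norm_eq_inner)
    have "(norm (transpose B *v x))\<^sup>2 = (\<Sum>j\<in>UNIV. ((transpose B *v x) $ j)\<^sup>2)"
        unfolding power2_norm_eq_inner by (simp add: inner_vec_def power2_eq_square)
    also have "\<dots> \<le> (\<Sum>j\<in>UNIV. (norm (transpose B $ j))\<^sup>2 * (norm x)\<^sup>2)"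
      by (intro sum_mono cs)
    also have "\<dots> = (norm (transpose B))\<^sup>2 * (norm x)\<^sup>2"
      by (simp add: rows sum_distrib_right)
    also have "(norm (transpose B))\<^sup>2 = (norm B)\<^sup>2"
      by (simp add: power2_norm_eq_inner inner_vec_def transpose_def) (rule sum.swap)
    finally have "(norm (transpose B *v x))\<^sup>2 \<le> (norm B * norm x)\<^sup>2"
      by (simp only: power_mult_distrib)
    then show ?thesis
      by (rule power2_le_imp_le) simp
  qed
  ultimately have le: "(norm ((A ** B) $ i))\<^sup>2 \<le> (norm B)\<^sup>2 * (norm (A $ i))\<^sup>2" for i
    unfolding power_mult_distrib[symmetric] by (intro power_mono) simp_all
  have "(norm (A ** B))\<^sup>2 \<le> (\<Sum>i\<in>UNIV. (norm B)\<^sup>2 * (norm (A $ i))\<^sup>2)"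
    unfolding rows[of "A ** B"] by (intro sum_mono le)
  also have "\<dots> = (norm A * norm B)\<^sup>2"
    by (simp add: rows[of A] sum_distrib_left power_mult_distrib mult.commute)
  finally show ?thesis
    by (rule power2_le_imp_le) simp
qed

lemma mat_exp_sums:
  fixes A :: "real^'n^'n"
  shows "(\<lambda>k. (1 / fact k) *\<^sub>R mat_power A k) sums mat_exp A"
proof -
  have le: "norm (mat_power A k) \<le> norm (mat 1 :: real^'n^'n) * norm A ^ k" for k
  proof (induction k)
    case (Suc k)
    have "norm (mat_power A (Suc k)) \<le> norm A * norm (mat_power A k)"
      by (simp add: norm_matrix_mult_le)
    also have "\<dots> \<le> norm A * (norm (mat 1 :: real^'n^'n) * norm A ^ k)"
      by (intro mult_left_mono Suc) simp
    finally show ?case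
      by (simp add: mult_ac)
  qed simp_all
  have "summable (\<lambda>k. norm (mat 1 :: real^'n^'n) * (norm A ^ k /\<^sub>R fact k))"
    by (intro summable_mult summable_exp_generic)
  then have "summable (\<lambda>k. (1 / fact k) *\<^sub>R mat_power A k)"
  proof (rule summable_comparison_test')
    fix k
    show "norm ((1 / fact k) *\<^sub>R mat_power A k) \<le> norm (mat 1 :: real^'n^'n) * (norm A ^ k /\<^sub>R fact k)"
      using le[of k] by (simp add: divide_simps mult.commute)
  qed
  then show ?thesis
    unfolding mat_exp_def by (rule summable_sums)
qed

lemma mat_exp_vector_sums:
  fixes A :: "real^'n^'n"
  shows "(\<lambda>k. (1 / fact k) *\<^sub>R (mat_power A k *v x)) sums (mat_exp A *v x)"
proof -
  have "linear (\<lambda>M :: real^'n^'n. M *v x)"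
    by (rule linearI) (simp_all add: matrix_vector_mult_add_rdistrib scaleR_matrix_vector_assoc)
  then have "bounded_linear (\<lambda>M :: real^'n^'n. M *v x)"
    by (simp add: linear_conv_bounded_linear)
  from bounded_linear.sums[OF this mat_exp_sums] show ?thesis
    by (simp add: scaleR_matrix_vector_assoc[symmetric])
qed

text \<open>On a plane that \<open>A\<close> rotates infinitesimally at speed \<open>t\<close>, the exponential is the rotation by
  \<open>t\<close>: the even and odd terms of the series are those of cosine and sine. The vectors \<open>x\<close> and \<open>y\<close>
  may be dependent or zero, so that \<open>t = 0\<close>, \<open>y = 0\<close> covers the kernel of \<open>A\<close>.\<close>

lemma mat_exp_rotation:
  fixes A :: "real^'n^'n"
  assumes "A *v x = t *\<^sub>R y" "A *v y = - t *\<^sub>R x"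
  shows "mat_exp A *v x = cos t *\<^sub>R x + sin t *\<^sub>R y"
proof -
  have "(1 / fact k) *\<^sub>R (mat_power A k *v x)
      = (cos_coeff k * t ^ k) *\<^sub>R x + (sin_coeff k * t ^ k) *\<^sub>R y" for k
  proof -
    have "mat_power A k *v x = (if even k then (- 1) ^ (k div 2) * t ^ k else 0) *\<^sub>R x
      + (if even k then 0 else (- 1) ^ ((k - 1) div 2) * t ^ k) *\<^sub>R y"
    proof (induction k)
      case (Suc k)
      then show ?case
        by (cases "even k") (auto simp: matrix_vector_mul_assoc[symmetric] matrix_vector_mult_scaleR
            assms elim!: evenE oddE)
    qed simp
    then show ?thesis
      by (simp add: cos_coeff_def sin_coeff_def)
  qed
  moreover have "(\<lambda>k. (cos_coeff k * t ^ k) *\<^sub>R x + (sin_coeff k * t ^ k) *\<^sub>R y)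
      sums (cos t *\<^sub>R x + sin t *\<^sub>R y)"
    using cos_converges[of t] sin_converges[of t] by (intro sums_add sums_scaleR_left) simp_all
  ultimately show ?thesis
    using mat_exp_vector_sums[of A x] sums_unique2 by force
qed

text \<open>For skew-symmetric \<open>A\<close> the matrix \<open>transpose A ** A\<close> is \<open>- (A ** A)\<close>, so an eigenvector \<open>u\<close> of it
  with eigenvalue \<open>t\<^sup>2\<close> spans together with \<open>A u / t\<close> a plane on which \<open>A\<close> is rotation at speed \<open>t\<close>.
  A real orthonormal basis of such vectors \<open>u\<close> replaces the complex diagonalization of \<open>A\<close>.\<close>

lemma skew_eigenplanes:
  fixes A :: "real^'n^'n"
  assumes "transpose A = - A"
  obtains u :: "'n \<Rightarrow> real^'n" and y t
  where "orthonormal_on UNIV u" "\<And>i. 0 \<le> t i" "\<And>i. norm (A *v u i) = t i"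
    "\<And>i. A *v u i = t i *\<^sub>R y i" "\<And>i. A *v y i = - t i *\<^sub>R u i"
proof -
  have neg: "(- A) *v x = - (A *v x)" for x
    using matrix_vector_mult_diff_rdistrib[of 0 A x] by simp
  have sym: "transpose (transpose A ** A) = transpose A ** A"
    by (simp add: matrix_transpose_mul)
  obtain u :: "'n \<Rightarrow> real^'n" and k where u: "orthonormal_on UNIV u" "\<And>i. (transpose A ** A) *v u i = k i *\<^sub>R u i"
    by (rule symmetric_eigenbasis[OF sym]) blast
  \<comment> \<open>\<open>u i\<close> is an eigenvector of \<open>A ** A\<close>, with eigenvalue \<open>- k i\<close>\<close>
  have AA: "A *v (A *v u i) = - k i *\<^sub>R u i" for i
  proof -
    have "- (A *v (A *v u i)) = k i *\<^sub>R u i"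
      using u(2)[of i] by (simp only: assms matrix_vector_mul_assoc[symmetric] neg)
    then show ?thesis
      by (metis minus_minus scaleR_minus_left)
  qed
  have k: "k i = (norm (A *v u i))\<^sup>2" for i
    unfolding power2_norm_eq_inner inner_matrix_vector_transpose
    using u(2)[of i] orthonormal_onD[OF u(1), of i i] by (simp add: matrix_vector_mul_assoc)
  define t where "t i = norm (A *v u i)" for i
  \<comment> \<open>if \<open>t i = 0\<close>, then \<open>y i = 0\<close> and both relations still hold\<close>
  define y where "y i = (1 / t i) *\<^sub>R (A *v u i)" for i
  have 1: "A *v u i = t i *\<^sub>R y i" for i
    by (auto simp: y_def t_def)
  have 2: "A *v y i = - t i *\<^sub>R u i" for i
  proof (cases "t i = 0")
    case False
    have "A *v y i = (1 / t i) *\<^sub>R (A *v (A *v u i))"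
      by (simp add: y_def matrix_vector_mult_scaleR)
    also have "\<dots> = (1 / t i * - (t i)\<^sup>2) *\<^sub>R u i"
      by (simp add: AA k t_def)
    also have "1 / t i * - (t i)\<^sup>2 = - t i"
      using False by (simp add: power2_eq_square)
    finally show ?thesis .
  qed (simp add: y_def)
  show ?thesis
    by (rule that[of u t y]) (use u(1) 1 2 in \<open>simp_all add: t_def\<close>)
qed

section \<open>Shortest logarithms and the distance on the special orthogonal group\<close>

text \<open>If all speeds of \<open>B\<close> are at most \<open>pi\<close>, then \<open>B\<close> is a shortest skew-symmetric logarithm of \<open>Q\<close>.
  Let \<open>t i\<close>, \<open>u i\<close> and \<open>s j\<close>, \<open>v j\<close> be the speeds and eigenbases of \<open>A\<close> and \<open>B\<close>. Both bases consist of
  eigenvectors of \<open>Q + transpose Q\<close>, with eigenvalues \<open>2 cos (t i)\<close> and \<open>2 cos (s j)\<close>. Hence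
  \<open>cos (t i) = cos (s j)\<close> whenever \<open>u i\<close> and \<open>v j\<close> are not orthogonal, and then \<open>s j \<le> t i\<close> since
  \<open>s j \<in> {0..pi}\<close> and cosine decreases there. Weighting \<open>(s j)\<^sup>2 \<le> (t i)\<^sup>2\<close> with \<open>(u i \<bullet> v j)\<^sup>2\<close>, whose rows and columns
  add up to one, gives the comparison of norms without matching the two families of eigenvalues.\<close>

lemma skew_log_norm_minimal:
  fixes A B Q :: "real^'n^'n"
  assumes A: "transpose A = - A" "mat_exp A = Q"
    and B: "transpose B = - B" "mat_exp B = Q"
    and Q: "orthogonal_matrix Q"
    and small: "\<And>x y s. x \<noteq> 0 \<Longrightarrow> 0 \<le> s \<Longrightarrow> B *v x = s *\<^sub>R y \<Longrightarrow> B *v y = - s *\<^sub>R x \<Longrightarrow> s \<le> pi"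
  shows "norm B \<le> norm A"
proof -
  obtain u :: "'n \<Rightarrow> real^'n" and y t where u: "orthonormal_on UNIV u" "\<And>i. 0 \<le> t i" "\<And>i. norm (A *v u i) = t i"
    "\<And>i. A *v u i = t i *\<^sub>R y i" "\<And>i. A *v y i = - t i *\<^sub>R u i"
    by (rule skew_eigenplanes[OF A(1)]) blast
  obtain v :: "'n \<Rightarrow> real^'n" and z s where v: "orthonormal_on UNIV v" "\<And>i. 0 \<le> s i" "\<And>i. norm (B *v v i) = s i"
    "\<And>i. B *v v i = s i *\<^sub>R z i" "\<And>i. B *v z i = - s i *\<^sub>R v i"
    by (rule skew_eigenplanes[OF B(1)]) blast
  have QQ: "transpose Q *v (Q *v x) = x" for x
    using Q by (simp add: matrix_vector_mul_assoc orthogonal_matrix)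
  have sym_part: "Q *v x + transpose Q *v x = (2 * cos r) *\<^sub>R x"
    if "C *v x = r *\<^sub>R w" "C *v w = - r *\<^sub>R x" "mat_exp C = Q" for C x w r
  proof -
    have x: "Q *v x = cos r *\<^sub>R x + sin r *\<^sub>R w"
      using mat_exp_rotation[OF that(1,2)] that(3) by simp
    have w: "Q *v w = cos r *\<^sub>R w - sin r *\<^sub>R x"
      using mat_exp_rotation[of C w "- r" x] that by simp
    have "Q *v (cos r *\<^sub>R x - sin r *\<^sub>R w)
        = ((cos r)\<^sup>2 + (sin r)\<^sup>2) *\<^sub>R x"
      unfolding scaleR_add_left power2_eq_square
      by (simp add: matrix_vector_mult_diff_distrib matrix_vector_mult_scaleR x w algebra_simps)
    then have "transpose Q *v x = cos r *\<^sub>R x - sin r *\<^sub>R w"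
      using QQ[of "cos r *\<^sub>R x - sin r *\<^sub>R w"] by simp
    moreover have "2 * cos r = cos r + cos r"
      by simp
    ultimately show ?thesis
      by (simp only: x scaleR_add_left) simp
  qed
  have coupled: "(u i \<bullet> v j) * cos (t i) = (u i \<bullet> v j) * cos (s j)" for i j
  proof -
    have "(Q *v u i + transpose Q *v u i) \<bullet> v j = u i \<bullet> (Q *v v j + transpose Q *v v j)"
      by (simp add: inner_add_left inner_add_right inner_matrix_vector_transpose dot_lmul_matrix)
    then show ?thesis
      by (simp only: sym_part[OF u(4,5) A(2)] sym_part[OF v(4,5) B(2)]) simp
  qed
  have s_pi: "s j \<le> pi" for j
    using small[OF _ v(2,4,5)] orthonormal_onD[OF v(1), of j j] by force
  have le: "(s j)\<^sup>2 * (u i \<bullet> v j)\<^sup>2 \<le> (t i)\<^sup>2 * (u i \<bullet> v j)\<^sup>2" for i j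
  proof (cases "u i \<bullet> v j = 0")
    case False
    then have "cos (t i) = cos (s j)"
      using coupled[of i j] by simp
    then have "s j \<le> t i"
      using cos_monotone_0_pi[OF u(2) _ s_pi, of i j] by force
    then show ?thesis
      using v(2) by (simp add: mult_right_mono power_mono)
  qed simp
  have one: "(\<Sum>j\<in>UNIV. (w \<bullet> e j)\<^sup>2) = 1"
    if "orthonormal_on UNIV e" "w \<bullet> w = 1" for e :: "'n \<Rightarrow> real^'n" and w
    using orthonormal_parseval[OF that(1), of w w] that(2) by (simp add: power2_eq_square)
  have ui: "u i \<bullet> u i = 1" and vi: "v i \<bullet> v i = 1" for i
    using orthonormal_onD[OF u(1)] orthonormal_onD[OF v(1)] by auto
  have sum_v: "(\<Sum>j\<in>UNIV. (u i \<bullet> v j)\<^sup>2) = 1" for i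
    by (rule one[OF v(1) ui])
  have sum_u: "(\<Sum>i\<in>UNIV. (u i \<bullet> v j)\<^sup>2) = 1" for j
    using one[OF u(1) vi, of j] by (simp only: inner_commute[of "v j"])
  have "(norm B)\<^sup>2 = (\<Sum>j\<in>UNIV. (s j)\<^sup>2 * (\<Sum>i\<in>UNIV. (u i \<bullet> v j)\<^sup>2))"
    by (simp add: norm_matrix_square_orthonormal[OF v(1)] v(3) sum_u)
  also have "\<dots> = (\<Sum>i\<in>UNIV. \<Sum>j\<in>UNIV. (s j)\<^sup>2 * (u i \<bullet> v j)\<^sup>2)"
    by (simp add: sum_distrib_left) (rule sum.swap)
  also have "\<dots> \<le> (\<Sum>i\<in>UNIV. \<Sum>j\<in>UNIV. (t i)\<^sup>2 * (u i \<bullet> v j)\<^sup>2)"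
    by (intro sum_mono le)
  also have "\<dots> = (norm A)\<^sup>2"
    by (simp add: norm_matrix_square_orthonormal[OF u(1)] u(3) sum_v sum_distrib_left[symmetric])
  finally show ?thesis
    by (rule power2_le_imp_le) simp
qed

definition outer_product :: "real^'m \<Rightarrow> real^'n \<Rightarrow> real^'n^'m" where
  "outer_product x y = (\<chi> i j. x $ i * y $ j)"

lemma outer_product_vector: "outer_product x y *v z = (y \<bullet> z) *\<^sub>R x"
  by (simp add: outer_product_def vec_eq_iff matrix_vector_mult_def inner_vec_def
      sum_distrib_left mult_ac)

lemma inner_outer_product:
  "outer_product x y \<bullet> outer_product z w = (x \<bullet> z) * (y \<bullet> w)"
  unfolding inner_vec_def sum_product
  by (simp add: outer_product_def mult_ac)

lemma matrix_sum_vector: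
  fixes M :: "'i \<Rightarrow> real^'n^'m"
  shows "(\<Sum>i\<in>I. M i) *v x = (\<Sum>i\<in>I. M i *v x)"
proof -
  have "linear (\<lambda>M :: real^'n^'m. M *v x)"
    by (rule linearI) (simp_all add: matrix_vector_mult_add_rdistrib scaleR_matrix_vector_assoc)
  then show ?thesis
    by (rule linear_sum)
qed

lemma matrix_eq_by_orthogonal_split:
  fixes P Q :: "real^'n^'n"
  assumes S: "\<And>x. x \<in> S \<Longrightarrow> P *v x = Q *v x"
    and perp: "\<And>x. (\<And>y. y \<in> S \<Longrightarrow> y \<bullet> x = 0) \<Longrightarrow> P *v x = Q *v x"
  shows "P = Q"
proof -
  have "P *v x = Q *v x" for x
  proof -
    obtain y z where yz: "y \<in> span S" "\<And>w. w \<in> span S \<Longrightarrow> orthogonal z w" "x = y + z"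
      by (rule orthogonal_subspace_decomp_exists[of S x]) blast
    have "P *v y = Q *v y"
      by (rule linear_eq_on[OF _ _ yz(1) S]) simp_all
    moreover have "P *v z = Q *v z"
      using yz(2) by (intro perp) (metis inner_commute orthogonal_def span_base)
    ultimately show ?thesis
      by (simp add: yz(3) matrix_vector_right_distrib)
  qed
  then show ?thesis
    by (simp add: matrix_eq)
qed

text \<open>Let \<open>Q\<close> rotate the mutually orthogonal planes spanned by \<open>a i\<close> and \<open>b i\<close> by angles
  \<open>t i \<in> {0..pi}\<close> and fix their common complement. The obvious logarithm \<open>A\<close> rotates each plane at
  speed \<open>t i\<close>. It has no speed above \<open>pi\<close>, so it realizes the distance. For an index with
  \<open>t i = 0\<close> there is no plane but only the fixed line spanned by \<open>a i\<close>, and \<open>b i\<close> is zero.\<close>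

proposition d_SO_eq_rotation_angles:
  fixes U V Q :: "real^'n^'n" and a b :: "'i \<Rightarrow> real^'n"
  assumes I: "finite I" and a: "orthonormal_on I a"
    and ab: "\<And>i j. i \<in> I \<Longrightarrow> j \<in> I \<Longrightarrow> a i \<bullet> b j = 0"
    and b: "\<And>i j. i \<in> I \<Longrightarrow> j \<in> I \<Longrightarrow> b i \<bullet> b j = (if i = j \<and> t i \<noteq> 0 then 1 else 0)"
    and t: "\<And>i. i \<in> I \<Longrightarrow> 0 \<le> t i" "\<And>i. i \<in> I \<Longrightarrow> t i \<le> pi"
    and UV: "matrix_inv U ** V = Q" and Q: "orthogonal_matrix Q"
    and Qa: "\<And>i. i \<in> I \<Longrightarrow> Q *v a i = cos (t i) *\<^sub>R a i + sin (t i) *\<^sub>R b i"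
    and Qb: "\<And>i. i \<in> I \<Longrightarrow> Q *v b i = cos (t i) *\<^sub>R b i - sin (t i) *\<^sub>R a i"
    and Qfix: "\<And>x. (\<And>i. i \<in> I \<Longrightarrow> a i \<bullet> x = 0 \<and> b i \<bullet> x = 0) \<Longrightarrow> Q *v x = x"
  shows "d_SO U V = sqrt (\<Sum>i\<in>I. (t i)\<^sup>2)"
proof -
  define K where "K i = outer_product (b i) (a i) - outer_product (a i) (b i)" for i
  define A where "A = (\<Sum>i\<in>I. t i *\<^sub>R K i)"
  have skew: "transpose A = - A"
    by (simp add: A_def K_def outer_product_def transpose_def vec_eq_iff sum_component
        sum_negf[symmetric] right_diff_distrib mult.commute)
  have Av: "A *v x = (\<Sum>i\<in>I. t i *\<^sub>R ((a i \<bullet> x) *\<^sub>R b i - (b i \<bullet> x) *\<^sub>R a i))" for x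
    by (simp add: A_def K_def matrix_sum_vector scaleR_matrix_vector_assoc[symmetric]
        matrix_vector_mult_diff_rdistrib outer_product_vector)
  have Aa: "A *v a k = t k *\<^sub>R b k" if "k \<in> I" for k
  proof -
    have "A *v a k = (\<Sum>i\<in>I. if i = k then t i *\<^sub>R b i else 0)"
      unfolding Av using that
      by (intro sum.cong) (auto simp: orthonormal_onD[OF a] ab inner_commute[of "b _"])
    then show ?thesis
      using I that by simp
  qed
  have Ab: "A *v b k = - t k *\<^sub>R a k" if "k \<in> I" for k
  proof -
    have "A *v b k = (\<Sum>i\<in>I. if i = k then - t i *\<^sub>R a i else 0)"
      unfolding Av using that by (intro sum.cong) (auto simp: ab b)
    then show ?thesis
      using I that by simp
  qed
  have A0: "A *v x = 0" if "\<And>i. i \<in> I \<Longrightarrow> a i \<bullet> x = 0 \<and> b i \<bullet> x = 0" for x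
    unfolding Av using that by (intro sum.neutral) simp
  have expA: "mat_exp A = Q"
  proof (rule matrix_eq_by_orthogonal_split[of "a ` I \<union> b ` I"])
    fix x assume "x \<in> a ` I \<union> b ` I"
    then consider i where "i \<in> I" "x = a i" | i where "i \<in> I" "x = b i"
      by blast
    then show "mat_exp A *v x = Q *v x"
    proof cases
      case 1
      then show ?thesis
        using mat_exp_rotation[OF Aa Ab] Qa by simp
    next
      case (2 i)
      then have "mat_exp A *v b i = cos (- t i) *\<^sub>R b i + sin (- t i) *\<^sub>R a i"
        using Aa Ab by (intro mat_exp_rotation) auto
      then show ?thesis
        using 2 Qb by simp
    qed
  next
    fix x assume "\<And>y. y \<in> a ` I \<union> b ` I \<Longrightarrow> y \<bullet> x = 0"
    then have *: "a i \<bullet> x = 0 \<and> b i \<bullet> x = 0" if "i \<in> I" for i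
      using that by blast
    have "mat_exp A *v x = cos 0 *\<^sub>R x + sin 0 *\<^sub>R 0"
      using A0[of x] * by (intro mat_exp_rotation) auto
    then show "mat_exp A *v x = Q *v x"
      using Qfix * by simp
  qed
  have "(norm A)\<^sup>2 = (\<Sum>i\<in>I. \<Sum>j\<in>I. t i * t j * (K i \<bullet> K j))"
    by (simp add: power2_norm_eq_inner A_def inner_sum_left inner_sum_right sum_distrib_left mult_ac)
      (simp add: inner_commute)
  also have "\<dots> = (\<Sum>i\<in>I. \<Sum>j\<in>I. if i = j then 2 * (t i)\<^sup>2 else 0)"
    by (intro sum.cong refl)
      (auto simp: K_def inner_diff_left inner_diff_right inner_outer_product orthonormal_onD[OF a]
        ab b inner_commute[of "b _" "a _"] power2_eq_square)
  also have "\<dots> = 2 * (\<Sum>i\<in>I. (t i)\<^sup>2)"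
    using I by (simp add: sum_distrib_left)
  finally have normA: "norm A = sqrt 2 * sqrt (\<Sum>i\<in>I. (t i)\<^sup>2)"
    by (metis norm_ge_zero real_sqrt_mult real_sqrt_unique)
  have skew_inner: "y \<bullet> (A *v z) = - ((A *v y) \<bullet> z)" for y z
    using matrix_vector_mult_diff_rdistrib[of 0 A z]
    by (simp only: inner_matrix_vector_transpose skew) simp
  \<comment> \<open>an eigenvector of \<open>A ** A\<close> with \<open>s > pi\<close> would be orthogonal to those with speeds \<open>t i\<close>, hence in the kernel of \<open>A\<close>\<close>
  have small: "s \<le> pi"
    if x: "x \<noteq> 0" and s: "0 \<le> s" "A *v x = s *\<^sub>R y" "A *v y = - s *\<^sub>R x" for x y s
  proof (rule ccontr)
    assume "\<not> s \<le> pi"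
    have perp: "w \<bullet> x = 0" if w: "A *v (A *v w) = - (r\<^sup>2) *\<^sub>R w" and r: "0 \<le> r" "r \<le> pi" for w r
    proof -
      have "r\<^sup>2 < s\<^sup>2"
        using \<open>\<not> s \<le> pi\<close> r by (intro power_strict_mono) auto
      have "w \<bullet> (A *v (A *v x)) = (A *v (A *v w)) \<bullet> x"
        by (simp add: skew_inner)
      then have "s\<^sup>2 * (w \<bullet> x) = r\<^sup>2 * (w \<bullet> x)"
        by (simp add: s w matrix_vector_mult_scaleR power2_eq_square)
      then show ?thesis
        using \<open>r\<^sup>2 < s\<^sup>2\<close> by auto
    qed
    have "A *v (A *v a i) = - ((t i)\<^sup>2) *\<^sub>R a i" "A *v (A *v b i) = - ((t i)\<^sup>2) *\<^sub>R b i"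
      if "i \<in> I" for i
      using that by (simp_all add: Aa Ab matrix_vector_mult_scaleR power2_eq_square
          del: scaleR_minus_left)
    then have "A *v x = 0"
      using t by (intro A0) (blast intro: perp)
    then have "y = 0 \<or> s = 0"
      using s(2) by auto
    then show False
      using s(3) x \<open>\<not> s \<le> pi\<close> pi_gt_zero by auto
  qed
  have "d_SO U V = 1 / sqrt 2 * norm A"
    unfolding d_SO_def UV
  proof (rule cInf_eq_minimum)
    show "1 / sqrt 2 * norm A \<in> {1 / sqrt 2 * norm A |A. A \<in> so_algebra \<and> mat_exp A = Q}"
      using skew expA by (auto simp: so_algebra_def)
  next
    fix d assume "d \<in> {1 / sqrt 2 * norm A |A. A \<in> so_algebra \<and> mat_exp A = Q}"
    then obtain C where C: "d = 1 / sqrt 2 * norm C" "transpose C = - C" "mat_exp C = Q"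
      by (auto simp: so_algebra_def)
    show "1 / sqrt 2 * norm A \<le> d"
      unfolding C(1) by (intro mult_left_mono skew_log_norm_minimal[OF C(2,3) skew expA Q small]) auto
  qed
  then show ?thesis
    by (simp add: normA)
qed

section \<open>Singular values and principal vectors\<close>

lemma transpose_mult_eq_mat_1_iff:
  fixes B :: "real^'m^'n"
  shows "transpose B ** B = mat 1 \<longleftrightarrow> orthonormal_on UNIV (\<lambda>i. column i B)"
  by (auto simp: vec_eq_iff matrix_matrix_mult_def mat_def transpose_def orthonormal_on_def
      inner_vec_def column_def)

lemma column_matrix_mult: "column j (A ** B) = A *v column j B"
  by (simp add: vec_eq_iff column_def matrix_matrix_mult_def matrix_vector_mult_def)

lemma transpose_mult_nth: "(transpose P ** S) $ i $ j = column i P \<bullet> (column j S :: real^'n)"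
  by (simp add: matrix_matrix_mult_def transpose_def inner_vec_def column_def)

lemma column_columns_matrix: "column i (\<chi> r c. u c $ r) = u i"
  by (simp add: column_def vec_eq_iff)

lemma columns_eq_range: "columns B = range (\<lambda>i. column i B)"
  by (auto simp: columns_def)

lemma span_columns_mult_subset:
  fixes A :: "real^'m^'n"
  shows "span (columns (A ** B)) \<subseteq> span (columns A)"
  by (rule span_minimal)
    (auto simp: columns_eq_range column_matrix_mult subspace_span
      matrix_vector_mult_in_columnspace[unfolded columns_eq_range])

lemma column_mult_diag_mat: "column j (A ** diag_mat s) = s j *\<^sub>R column j A"
  by (simp add: vec_eq_iff column_def diag_mat_def matrix_matrix_mult_def if_distrib cong: if_cong)

text \<open>Normalize the images \<open>A v\<close> of an eigenbasis of \<open>transpose A ** A\<close>; they are orthogonal with norms the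
  singular values, and the indices with \<open>A v = 0\<close> are filled up by extending to a basis.\<close>

lemma singular_values_exist:
  fixes A :: "real^'m^'m"
  shows "\<exists>s. is_singular_values A s"
proof -
  have "transpose (transpose A ** A) = transpose A ** A"
    by (simp add: matrix_transpose_mul)
  then obtain v :: "'m \<Rightarrow> real^'m" and k where v: "orthonormal_on UNIV v"
      and k: "\<And>i. (transpose A ** A) *v v i = k i *\<^sub>R v i"
    by (rule symmetric_eigenbasis) blast
  have Av: "(A *v v i) \<bullet> (A *v v j) = (if i = j then k j else 0)" for i j
    using k[of j] orthonormal_onD[OF v, of i j]
    by (simp add: inner_matrix_vector_transpose matrix_vector_mul_assoc)
  define s where "s i = norm (A *v v i)" for i
  have ss: "s i * s i = k i" for i
    using Av[of i i] by (simp add: s_def power2_norm_eq_inner flip: power2_eq_square)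
  have "orthonormal_on {i. s i \<noteq> 0} (\<lambda>i. (1 / s i) *\<^sub>R (A *v v i))"
    by (auto simp: orthonormal_on_def Av ss[symmetric])
  then obtain u where u: "orthonormal_on UNIV u" "\<And>i. s i \<noteq> 0 \<Longrightarrow> u i = (1 / s i) *\<^sub>R (A *v v i)"
    by (rule orthonormal_extend) blast
  have su: "A *v v i = s i *\<^sub>R u i" for i
    by (cases "s i = 0") (auto simp: u(2), simp add: s_def)
  define U V where "U = (\<chi> r c. u c $ r)" and "V = (\<chi> r c. v c $ r)"
  have orth: "orthogonal_matrix U" "orthogonal_matrix V"
    using u(1) v by (simp_all add: orthogonal_matrix transpose_mult_eq_mat_1_iff U_def V_def
        column_columns_matrix)
  have "A ** V = U ** diag_mat s"
  proof -
    have "column j (A ** V) = column j (U ** diag_mat s)" for j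
      unfolding column_matrix_mult[of j A V] column_mult_diag_mat
      by (simp add: U_def V_def column_columns_matrix su)
    then show ?thesis
      by (simp add: vec_eq_iff column_def)
  qed
  then have "A = U ** diag_mat s ** transpose V"
    using orth(2) by (metis matrix_mul_assoc matrix_mul_rid orthogonal_matrix_def)
  then show ?thesis
    using orth unfolding is_singular_values_def s_def by (metis norm_ge_zero)
qed

lemma orthonormal_basis_matrix_exists:
  assumes "W \<in> Gr CARD('m::finite)"
  shows "\<exists>B :: real^('m::finite)^'n. orthonormal_basis_matrix B W"
proof -
  obtain u :: "'m \<Rightarrow> real^'n" where "orthonormal_on UNIV u" "span (range u) = W"
    using assms orthonormal_family_of_subspace[of W "UNIV :: 'm set"] by (auto simp: Gr_def)
  then have "orthonormal_basis_matrix (\<chi> r c. u c $ r) W"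
    by (simp add: orthonormal_basis_matrix_def transpose_mult_eq_mat_1_iff columns_eq_range
        column_columns_matrix)
  then show ?thesis
    by blast
qed

text \<open>Rotating the chosen orthonormal bases of \<open>W\<close> and \<open>Z\<close> by the two orthogonal factors of the
  singular value decomposition gives bases whose Gram matrix is the diagonal matrix of the
  cosines of the principal angles. This characterizes the angles independently of the choices in
  their definition.\<close>

lemma principal_vectors:
  fixes W Z :: "(real^'n) set"
  assumes "W \<in> Gr CARD('m::finite)" "Z \<in> Gr CARD('m::finite)"
  defines "\<phi> \<equiv> principal_angle TYPE('m::finite) W Z"
  obtains w z :: "'m::finite \<Rightarrow> real^'n"
  where "orthonormal_on UNIV w" "span (range w) = W"
    and "orthonormal_on UNIV z" "span (range z) = Z"
    and "\<And>i j. w i \<bullet> z j = (if i = j then cos (\<phi> i) else 0)"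
    and "\<And>i. 0 \<le> \<phi> i" "\<And>i. \<phi> i \<le> pi / 2"
proof -
  define B where "B = (SOME B :: real^'m^'n. orthonormal_basis_matrix B W)"
  define C where "C = (SOME B :: real^'m^'n. orthonormal_basis_matrix B Z)"
  define s where "s = singular_values (transpose B ** C)"
  have B: "transpose B ** B = mat 1" "span (columns B) = W"
    using someI_ex[OF orthonormal_basis_matrix_exists[OF assms(1)]]
    by (simp_all add: B_def orthonormal_basis_matrix_def)
  have C: "transpose C ** C = mat 1" "span (columns C) = Z"
    using someI_ex[OF orthonormal_basis_matrix_exists[OF assms(2)]]
    by (simp_all add: C_def orthonormal_basis_matrix_def)
  have "is_singular_values (transpose B ** C) s"
    unfolding s_def singular_values_def by (rule someI_ex[OF singular_values_exist])
  then obtain U V where s: "\<And>i. 0 \<le> s i" and UV: "orthogonal_matrix U" "orthogonal_matrix V"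
      and svd: "transpose B ** C = U ** diag_mat s ** transpose V"
    unfolding is_singular_values_def by blast
  have rotated: "transpose (M ** X) ** (M ** X) = mat 1 \<and> span (columns (M ** X)) = span (columns M)"
    if M: "transpose M ** M = mat 1" and X: "orthogonal_matrix X"
    for M :: "real^'m^'n" and X :: "real^'m^'m"
  proof
    have "transpose (M ** X) ** (M ** X) = transpose X ** (transpose M ** M) ** X"
      by (simp add: matrix_transpose_mul matrix_mul_assoc)
    then show "transpose (M ** X) ** (M ** X) = mat 1"
      using M X by (simp add: orthogonal_matrix)
    have "M = (M ** X) ** transpose X"
      using X by (simp add: matrix_mul_assoc[symmetric] orthogonal_matrix_def)
    then show "span (columns (M ** X)) = span (columns M)"
      using span_columns_mult_subset[of M X] span_columns_mult_subset[of "M ** X" "transpose X"]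
      by auto
  qed
  define w z where "w = (\<lambda>i. column i (B ** U))" and "z = (\<lambda>i. column i (C ** V))"
  have "transpose (B ** U) ** (C ** V) = transpose U ** (transpose B ** C) ** V"
    by (simp add: matrix_transpose_mul matrix_mul_assoc)
  also have "\<dots> = (transpose U ** U) ** diag_mat s ** (transpose V ** V)"
    by (simp only: svd matrix_mul_assoc)
  also have "\<dots> = diag_mat s"
    using UV by (simp add: orthogonal_matrix)
  finally have wz: "w i \<bullet> z j = (if i = j then s i else 0)" for i j
    by (simp add: w_def z_def flip: transpose_mult_nth) (simp add: diag_mat_def)
  have w: "orthonormal_on UNIV w" "span (range w) = W"
    using rotated[OF B(1) UV(1)] B(2)
    by (simp_all add: w_def transpose_mult_eq_mat_1_iff columns_eq_range)
  have z: "orthonormal_on UNIV z" "span (range z) = Z"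
    using rotated[OF C(1) UV(2)] C(2)
    by (simp_all add: z_def transpose_mult_eq_mat_1_iff columns_eq_range)
  have "s i \<le> 1" for i
  proof -
    have "norm (w i) = 1" "norm (z i) = 1"
      using orthonormal_onD[OF w(1), of i i] orthonormal_onD[OF z(1), of i i]
      by (simp_all add: norm_eq_1)
    then show ?thesis
      using norm_cauchy_schwarz[of "w i" "z i"] wz[of i i] by simp
  qed
  moreover have "\<phi> i = arccos (s i)" for i
    by (simp add: \<phi>_def principal_angle_def Let_def s_def B_def C_def)
  ultimately have "cos (\<phi> i) = s i" "0 \<le> \<phi> i" "\<phi> i \<le> pi / 2" for i
    using s[of i] arccos_le_pi2[of "s i"] by (simp_all add: cos_arccos arccos_lbound)
  with w z wz show ?thesis
    using that[of w z] by simp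
qed

section \<open>Reflections\<close>

text \<open>\<open>R\<close> acts as \<open>- 1\<close> on \<open>W\<close> and as \<open>1\<close> on the orthogonal complement of \<open>W\<close>. Level \<open>m\<close> involutions
  and sign-changes are both of this kind, with \<open>W\<close> an arbitrary and a coordinate \<open>m\<close>-plane.\<close>

definition reflection_negating :: "(real^'n) set \<Rightarrow> real^'n^'n \<Rightarrow> bool" where
  "reflection_negating W R \<longleftrightarrow>
     (\<forall>x\<in>W. R *v x = - x) \<and> (\<forall>x. (\<forall>y\<in>W. y \<bullet> x = 0) \<longrightarrow> R *v x = x)"

lemma reflection_negatingD:
  assumes "reflection_negating W R"
  shows "x \<in> W \<Longrightarrow> R *v x = - x" "(\<And>y. y \<in> W \<Longrightarrow> y \<bullet> x = 0) \<Longrightarrow> R *v x = x"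
  using assms by (auto simp: reflection_negating_def)

lemma inner_span_eq_0:
  assumes "\<And>b. b \<in> S \<Longrightarrow> b \<bullet> x = 0" "y \<in> span S"
  shows "y \<bullet> (x :: 'a::euclidean_space) = 0"
proof -
  have "subspace {y. y \<bullet> x = 0}"
    by (rule subspaceI) (auto simp: inner_add_left)
  then show ?thesis
    using assms span_minimal[of S "{y. y \<bullet> x = 0}"] by auto
qed

lemma matrix_vector_mult_minus: "A *v (- x) = - (A *v x)" for A :: "real^'n^'m"
  by (metis matrix_vector_mult_scaleR scaleR_minus1_left)

lemma subspace_orthogonal_decomposition:
  fixes W :: "'a::euclidean_space set"
  assumes "subspace W"
  obtains y z where "y \<in> W" "\<And>w. w \<in> W \<Longrightarrow> w \<bullet> z = 0" "x = y + z"
proof -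
  obtain y z where "y \<in> span W" "\<And>w. w \<in> span W \<Longrightarrow> orthogonal z w" "x = y + z"
    by (rule orthogonal_subspace_decomp_exists[of W x]) blast
  moreover have "span W = W"
    using assms by simp
  ultimately show ?thesis
    using that by (metis inner_commute orthogonal_def)
qed

lemma reflection_negating_square:
  assumes "reflection_negating W R"
  shows "R ** R = mat 1"
  by (rule matrix_eq_by_orthogonal_split[of W])
    (simp_all add: matrix_vector_mul_assoc[symmetric] reflection_negatingD[OF assms]
      matrix_vector_mult_minus)

lemma reflection_negating_orthogonal:
  assumes "subspace W" "reflection_negating W R"
  shows "orthogonal_matrix R"
proof -
  have "norm (R *v x) = norm x" for x
  proof -
    obtain y z where yz: "y \<in> W" "\<And>w. w \<in> W \<Longrightarrow> w \<bullet> z = 0" "x = y + z"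
      using subspace_orthogonal_decomposition[OF assms(1)] by blast
    have "R *v x = - y + z"
      using reflection_negatingD[OF assms(2)] yz by (simp add: matrix_vector_right_distrib)
    moreover have "y \<bullet> z = 0"
      using yz by simp
    ultimately show ?thesis
      by (simp add: yz(3) norm_eq inner_add_left inner_add_right inner_diff_left inner_diff_right
          inner_commute)
  qed
  then show ?thesis
    using orthogonal_transformation_matrix[of "(*v) R"]
    by (simp add: orthogonal_transformation)
qed

lemma reflection_negating_eigenspace:
  assumes "subspace W" "reflection_negating W R"
  shows "{x. R *v x = - x} = W"
proof (intro equalityI subsetI)
  fix x assume "x \<in> {x. R *v x = - x}"
  moreover obtain y z where yz: "y \<in> W" "\<And>w. w \<in> W \<Longrightarrow> w \<bullet> z = 0" "x = y + z"
    using subspace_orthogonal_decomposition[OF assms(1)] by blast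
  ultimately have "z = - z"
    using reflection_negatingD[OF assms(2)] by (simp add: matrix_vector_right_distrib)
  then show "x \<in> W"
    using yz by (simp add: eq_neg_iff_add_eq_0 flip: scaleR_2)
qed (use reflection_negatingD[OF assms(2)] in auto)

text \<open>If \<open>x\<close> is orthogonal to the negated space, it is orthogonal to \<open>x - R x\<close>, which \<open>R\<close> negates. As
  \<open>R x\<close> has the same norm as \<open>x\<close>, expanding the square of \<open>x - R x\<close> gives zero.\<close>

lemma involution_reflection_negating:
  assumes "involution R"
  shows "reflection_negating {x. R *v x = - x} R"
  unfolding reflection_negating_def
proof (intro conjI ballI allI impI)
  fix x assume perp: "\<forall>y\<in>{x. R *v x = - x}. y \<bullet> x = 0"
  have "R *v (R *v x) = x"
    using assms by (simp add: involution_def matrix_vector_mul_assoc)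
  then have "(x - R *v x) \<bullet> x = 0"
    using perp by (simp add: matrix_vector_mult_diff_distrib)
  moreover have "(R *v x) \<bullet> (R *v x) = x \<bullet> x"
    using assms by (simp add: involution_def SO_def inner_matrix_vector_transpose
        matrix_vector_mul_assoc orthogonal_matrix del: transpose_matrix_vector)
  ultimately have "(x - R *v x) \<bullet> (x - R *v x) = 0"
    by (simp add: inner_diff_left inner_diff_right inner_commute)
  then show "R *v x = x"
    by simp
qed simp

lemma subspace_negated: "subspace {x. R *v x = - x}" for R :: "real^'n^'n"
  by (rule subspaceI)
    (simp_all add: matrix_vector_right_distrib matrix_vector_mult_scaleR)

lemma matrix_inv_eq:
  fixes A B :: "real^'n^'n"
  assumes "A ** B = mat 1"
  shows "matrix_inv A = B"
proof -
  have "B ** A = mat 1"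
    using assms matrix_left_right_inverse by blast
  then have "A ** matrix_inv A = mat 1"
    using assms someI[of "\<lambda>X. A ** X = mat 1 \<and> X ** A = mat 1" B]
    unfolding matrix_inv_def by blast
  then show ?thesis
    using \<open>B ** A = mat 1\<close> by (metis matrix_mul_assoc matrix_mul_lid matrix_mul_rid)
qed

text \<open>Pair up an orthonormal basis of the even-dimensional \<open>W\<close>: on each of the \<open>k\<close> resulting planes
  the reflection is rotation by \<open>pi\<close>.\<close>

proposition d_SO_reflection:
  assumes W: "subspace W" "dim W = 2 * k" and R: "reflection_negating W R"
  shows "d_SO R (mat 1) = pi * sqrt (real k)"
proof -
  obtain u :: "nat \<Rightarrow> real^'a" where u: "orthonormal_on {..<2 * k} u" "span (u ` {..<2 * k}) = W"
    using orthonormal_family_of_subspace[OF W(1), of "{..<2 * k}"] W(2) by auto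
  have uW: "u i \<in> W" if "i < 2 * k" for i
    using that u(2) by (auto intro: span_base)
  have "d_SO R (mat 1) = sqrt (\<Sum>i<k. pi\<^sup>2)"
  proof (rule d_SO_eq_rotation_angles[where a = u and b = "\<lambda>i. u (k + i)" and Q = R])
    show "matrix_inv R ** mat 1 = R"
      using matrix_inv_eq[OF reflection_negating_square[OF R]] by simp
    show "orthogonal_matrix R"
      using reflection_negating_orthogonal W(1) R by blast
    show "R *v x = x" if x: "\<And>i. i \<in> {..<k} \<Longrightarrow> u i \<bullet> x = 0 \<and> u (k + i) \<bullet> x = 0" for x
    proof (rule reflection_negatingD(2)[OF R])
      have "u i \<bullet> x = 0" if "i < 2 * k" for i
        using x[of i] x[of "i - k"] that by (cases "i < k") auto
      then show "y \<bullet> x = 0" if "y \<in> W" for y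
        using that inner_span_eq_0[of "u ` {..<2 * k}" x y] u(2) by auto
    qed
  qed (use orthonormal_onD[OF u(1)] uW reflection_negatingD(1)[OF R] pi_gt_zero in
      \<open>auto simp: orthonormal_on_def\<close>)
  then show ?thesis
    by (simp add: real_sqrt_mult mult.commute)
qed

text \<open>For principal vectors \<open>w i\<close> and \<open>z i\<close> enclosing the angle \<open>\<phi> i\<close>, both reflections preserve the
  plane spanned by \<open>w i\<close> and \<open>z i\<close> and act there as reflections in lines enclosing the angle \<open>\<phi> i\<close>; their product
  is the rotation by \<open>2 * \<phi> i\<close>, an angle in \<open>{0..pi}\<close>. If \<open>w i = z i\<close>, the plane shrinks to a line, which
  the product fixes. The planes are mutually orthogonal, and
  what is orthogonal to all of them is fixed by both reflections.\<close>

proposition d_SO_product_of_reflections: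
  fixes W Z :: "(real^'n) set"
  assumes W: "W \<in> Gr CARD('m::finite)" and Z: "Z \<in> Gr CARD('m::finite)"
    and R: "reflection_negating W R" and T: "reflection_negating Z T"
  shows "d_SO (R ** T) (mat 1) = 2 * d_Gr TYPE('m::finite) W Z"
proof -
  define \<phi> where "\<phi> = principal_angle TYPE('m) W Z"
  obtain w z :: "'m \<Rightarrow> real^'n"
    where w: "orthonormal_on UNIV w" "span (range w) = W"
    and z: "orthonormal_on UNIV z" "span (range z) = Z"
    and wz: "\<And>i j. w i \<bullet> z j = (if i = j then cos (\<phi> i) else 0)"
    and \<phi>: "\<And>i. 0 \<le> \<phi> i" "\<And>i. \<phi> i \<le> pi / 2"
    unfolding \<phi>_def by (rule principal_vectors[OF W Z]) blast
  \<comment> \<open>unit vector completing \<open>w i\<close> to a basis of the plane of \<open>w i\<close> and \<open>z i\<close>; it is zero if they coincide, as \<open>1 / 0 = 0\<close>\<close>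
  define b where "b i = (1 / sin (\<phi> i)) *\<^sub>R (z i - cos (\<phi> i) *\<^sub>R w i)" for i
  \<comment> \<open>the vector of that plane orthogonal to \<open>z i\<close>, which \<open>T\<close> fixes\<close>
  define c where "c i = cos (\<phi> i) *\<^sub>R b i - sin (\<phi> i) *\<^sub>R w i" for i
  note ww = orthonormal_onD[OF w(1) UNIV_I UNIV_I] and zz = orthonormal_onD[OF z(1) UNIV_I UNIV_I]
  have sin0: "sin (\<phi> i) = 0 \<longleftrightarrow> \<phi> i = 0" for i
  proof
    assume "sin (\<phi> i) = 0"
    moreover have "\<phi> i < pi"
      using \<phi>(2)[of i] pi_gt_zero by linarith
    ultimately show "\<phi> i = 0"
      using \<phi>(1)[of i] sin_gt_zero[of "\<phi> i"] by force
  qed simp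
  have z_eq: "z i = cos (\<phi> i) *\<^sub>R w i + sin (\<phi> i) *\<^sub>R b i" for i
  proof (cases "\<phi> i = 0")
    case True
    have "(z i - w i) \<bullet> (z i - w i) = 0"
      by (simp add: inner_diff_left inner_diff_right ww zz wz inner_commute[of "z i" "w i"] True)
    then show ?thesis
      by (simp add: True)
  next
    case False
    then show ?thesis
      by (simp add: b_def sin0)
  qed
  have wb: "w i \<bullet> b j = 0" for i j
    by (simp add: b_def inner_diff_right wz ww)
  have bb: "b i \<bullet> b j = (if i = j \<and> \<phi> i \<noteq> 0 then 1 else 0)" for i j
  proof -
    have "(z i - cos (\<phi> i) *\<^sub>R w i) \<bullet> (z j - cos (\<phi> j) *\<^sub>R w j)
        = (if i = j then (sin (\<phi> i))\<^sup>2 else 0)"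
      using sin_cos_squared_add[of "\<phi> i"]
      by (auto simp: inner_diff_left inner_diff_right ww zz wz inner_commute[of "z _" "w _"]
          power2_eq_square)
    then show ?thesis
      by (simp add: b_def sin0 power2_eq_square)
  qed
  have zb: "z i \<bullet> b j = (if i = j then sin (\<phi> j) else 0)" for i j
    unfolding z_eq by (auto simp: inner_add_left wb bb)
  have zc: "z i \<bullet> c j = 0" for i j
    by (simp add: c_def inner_diff_right zb wz inner_commute[of "z _" "w _"])
  have Rw: "R *v w i = - w i" for i
    using w(2) by (intro reflection_negatingD(1)[OF R]) (auto intro: span_base)
  have Rb: "R *v b i = b i" for i
    using w(2) inner_span_eq_0[of "range w" "b i"] wb by (intro reflection_negatingD(2)[OF R]) blast
  have Tz: "T *v z i = - z i" for i
    using z(2) by (intro reflection_negatingD(1)[OF T]) (auto intro: span_base)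
  have Tc: "T *v c i = c i" for i
    using z(2) inner_span_eq_0[of "range z" "c i"] zc by (intro reflection_negatingD(2)[OF T]) blast
  have unit: "x = ((cos (\<phi> i))\<^sup>2 + (sin (\<phi> i))\<^sup>2) *\<^sub>R x" for i and x :: "real^'n"
    by simp
  have w_eq: "w i = cos (\<phi> i) *\<^sub>R z i - sin (\<phi> i) *\<^sub>R c i" for i
    by (subst unit[of _ i]) (simp only: c_def z_eq[of i] scaleR_add_left scaleR_add_right
        scaleR_diff_right scaleR_scaleR power2_eq_square, simp add: algebra_simps)
  have b_eq: "b i = sin (\<phi> i) *\<^sub>R z i + cos (\<phi> i) *\<^sub>R c i" for i
    by (subst unit[of _ i]) (simp only: c_def z_eq[of i] scaleR_add_left scaleR_add_right
        scaleR_diff_right scaleR_scaleR power2_eq_square, simp add: algebra_simps)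
  have TRw: "(T ** R) *v w i = cos (2 * \<phi> i) *\<^sub>R w i + sin (2 * \<phi> i) *\<^sub>R b i" for i
  proof -
    have "(T ** R) *v w i = - (T *v w i)"
      by (simp add: matrix_vector_mul_assoc[symmetric] Rw matrix_vector_mult_minus)
    also have "\<dots> = cos (\<phi> i) *\<^sub>R z i + sin (\<phi> i) *\<^sub>R c i"
      by (subst w_eq) (simp add: matrix_vector_mult_diff_distrib matrix_vector_mult_scaleR Tz Tc)
    also have "\<dots> = ((cos (\<phi> i))\<^sup>2 - (sin (\<phi> i))\<^sup>2) *\<^sub>R w i + (sin (\<phi> i) * cos (\<phi> i) + sin (\<phi> i) * cos (\<phi> i)) *\<^sub>R b i"
      unfolding z_eq c_def by (simp add: vec_eq_iff power2_eq_square algebra_simps)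
    finally show ?thesis
      unfolding cos_double sin_double by (simp only: mult_2 distrib_right)
  qed
  have TRb: "(T ** R) *v b i = cos (2 * \<phi> i) *\<^sub>R b i - sin (2 * \<phi> i) *\<^sub>R w i" for i
  proof -
    have "(T ** R) *v b i = T *v b i"
      by (simp add: matrix_vector_mul_assoc[symmetric] Rb)
    also have "\<dots> = cos (\<phi> i) *\<^sub>R c i - sin (\<phi> i) *\<^sub>R z i"
      by (subst b_eq) (simp add: matrix_vector_right_distrib matrix_vector_mult_scaleR Tz Tc)
    also have "\<dots> = ((cos (\<phi> i))\<^sup>2 - (sin (\<phi> i))\<^sup>2) *\<^sub>R b i - (sin (\<phi> i) * cos (\<phi> i) + sin (\<phi> i) * cos (\<phi> i)) *\<^sub>R w i"
      unfolding z_eq c_def by (simp add: vec_eq_iff power2_eq_square algebra_simps)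
    finally show ?thesis
      unfolding cos_double sin_double by (simp only: mult_2 distrib_right)
  qed
  have TRfix: "(T ** R) *v x = x" if x: "\<And>i. w i \<bullet> x = 0 \<and> b i \<bullet> x = 0" for x
  proof -
    have zx: "z i \<bullet> x = 0" for i
      unfolding z_eq by (simp add: inner_add_left x)
    have "R *v x = x"
      using w(2) inner_span_eq_0[of "range w" x] x by (intro reflection_negatingD(2)[OF R]) blast
    moreover have "T *v x = x"
      using z(2) inner_span_eq_0[of "range z" x] zx by (intro reflection_negatingD(2)[OF T]) blast
    ultimately show ?thesis
      by (simp add: matrix_vector_mul_assoc[symmetric])
  qed
  \<comment> \<open>the definition of the distance refers to logarithms of the inverse of \<open>R ** T\<close>\<close>
  have "(R ** T) ** (T ** R) = R ** (T ** T) ** R"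
    by (simp only: matrix_mul_assoc)
  then have inv: "matrix_inv (R ** T) ** mat 1 = T ** R"
    using reflection_negating_square[OF R] reflection_negating_square[OF T]
    by (simp add: matrix_inv_eq)
  have "subspace W" "subspace Z"
    using W Z by (auto simp: Gr_def)
  then have orth: "orthogonal_matrix (T ** R)"
    using reflection_negating_orthogonal R T by (blast intro: orthogonal_matrix_mul)
  have "d_SO (R ** T) (mat 1) = sqrt (\<Sum>i\<in>UNIV. (2 * \<phi> i)\<^sup>2)"
  proof (rule d_SO_eq_rotation_angles[OF finite w(1) wb _ _ _ inv orth TRw TRb])
    show "2 * \<phi> i \<le> pi" for i
      using \<phi>(2)[of i] by simp
  qed (use \<phi>(1) bb TRfix in auto)
  also have "\<dots> = 2 * d_Gr TYPE('m) W Z"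
    by (simp add: d_Gr_def \<phi>_def power_mult_distrib real_sqrt_mult flip: sum_distrib_left)
  finally show ?thesis .
qed

section \<open>Reflections of even level and sign-changes\<close>

lemma prod_sign: "(\<Prod>i\<in>UNIV. if i \<in> J then - 1 else 1 :: real) = (- 1) ^ card (J :: 'n::finite set)"
proof -
  have "(\<Prod>i\<in>UNIV. if i \<in> J then - 1 else 1 :: real) = (\<Prod>i\<in>J. - 1)"
    by (simp add: prod.If_cases)
  then show ?thesis
    by simp
qed

text \<open>In an orthonormal basis adapted to \<open>W\<close> the reflection is diagonal with \<open>dim W\<close> entries \<open>- 1\<close>, so it has
  determinant one exactly when \<open>dim W\<close> is even.\<close>

lemma reflection_negating_exists:
  fixes W :: "(real^'n) set"
  assumes W: "subspace W" and even: "even (dim W)"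
  obtains R where "reflection_negating W R" "R \<in> SO"
proof -
  have "dim W \<le> CARD('n)"
    using dim_subset_UNIV[of W] by simp
  then obtain J :: "'n set" where J: "card J = dim W"
    using obtain_subset_with_card_n[of "dim W" "UNIV :: 'n set"] by auto
  obtain u0 where u0: "orthonormal_on J u0" "span (u0 ` J) = W"
    using orthonormal_family_of_subspace[OF W finite J] by blast
  obtain u where u: "orthonormal_on UNIV u" "\<And>i. i \<in> J \<Longrightarrow> u i = u0 i"
    by (rule orthonormal_extend[OF u0(1)]) blast
  have uW: "span (u ` J) = W"
    using u0(2) u(2) by (metis image_cong)
  define \<sigma> :: "'n \<Rightarrow> real" where "\<sigma> i = (if i \<in> J then - 1 else 1)" for i
  define V where "V = (\<chi> r c. u c $ r)"
  define R where "R = V ** diag_mat \<sigma> ** transpose V"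
  have V: "orthogonal_matrix V"
    using u(1) by (simp add: orthogonal_matrix transpose_mult_eq_mat_1_iff V_def column_columns_matrix)
  have "R ** V = V ** diag_mat \<sigma>"
    using V by (metis R_def matrix_mul_assoc matrix_mul_rid orthogonal_matrix_def)
  then have Ru: "R *v u j = \<sigma> j *\<^sub>R u j" for j
    using column_matrix_mult[of j R V] column_mult_diag_mat[of j V \<sigma>]
    by (simp add: V_def column_columns_matrix)
  have "reflection_negating W R"
    unfolding reflection_negating_def
  proof (intro conjI ballI allI impI)
    fix x assume "x \<in> W"
    then have "x \<in> span (u ` J)"
      using uW by simp
    then show "R *v x = - x"
      by (rule linear_eq_on[where f = "(*v) R" and g = uminus, rotated 2])
        (auto simp: Ru \<sigma>_def linear_uminus)
  next
    fix x assume x: "\<forall>y\<in>W. y \<bullet> x = 0"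
    have x0: "x \<bullet> u i = 0" if "i \<in> J" for i
      using x that uW by (metis inner_commute image_eqI span_base)
    have "R *v x = R *v (\<Sum>i\<in>UNIV. (x \<bullet> u i) *\<^sub>R u i)"
      using orthonormal_expansion[OF u(1), of x] by simp
    also have "\<dots> = (\<Sum>i\<in>UNIV. (x \<bullet> u i) *\<^sub>R (\<sigma> i *\<^sub>R u i))"
      by (simp add: linear_sum[OF matrix_vector_mul_linear] matrix_vector_mult_scaleR Ru)
    also have "\<dots> = (\<Sum>i\<in>UNIV. (x \<bullet> u i) *\<^sub>R u i)"
      by (intro sum.cong refl) (auto simp: \<sigma>_def x0)
    also have "\<dots> = x"
      using orthonormal_expansion[OF u(1), of x] by simp
    finally show "R *v x = x" .
  qed
  moreover from this have "R \<in> SO"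
  proof -
    have "det V * det V = 1"
      using det_orthogonal_matrix[OF V] by auto
    moreover have "det (diag_mat \<sigma>) = 1"
      using even by (simp add: det_diagonal diag_mat_def \<sigma>_def prod_sign J)
    ultimately have "det R = 1"
      by (simp add: R_def det_mul det_transpose)
    then show ?thesis
      using reflection_negating_orthogonal[OF W \<open>reflection_negating W R\<close>] by (simp add: SO_def)
  qed
  ultimately show ?thesis
    using that by blast
qed

lemma reflection_negating_coord_plane:
  assumes "\<And>i. \<sigma> i \<in> {1, - 1}"
  shows "reflection_negating (coord_plane {i. \<sigma> i = - 1}) (diag_mat \<sigma>)"
proof -
  have diag: "(diag_mat \<sigma> *v x) $ i = \<sigma> i * x $ i" for x i
    by (simp add: diag_mat_def matrix_vector_mult_def if_distrib[of "\<lambda>a. a * _"] cong: if_cong)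
  have "diag_mat \<sigma> *v x = x" if x: "\<forall>y\<in>coord_plane {i. \<sigma> i = - 1}. y \<bullet> x = 0" for x
  proof -
    have "x $ i = 0" if "\<sigma> i = - 1" for i
    proof -
      have "axis i 1 \<in> coord_plane {i. \<sigma> i = - 1}"
        using that by (auto simp: coord_plane_def axis_def)
      then show ?thesis
        using x by (auto simp: inner_axis')
    qed
    then have "(diag_mat \<sigma> *v x) $ i = x $ i" for i
      using assms[of i] by (auto simp: diag)
    then show ?thesis
      by (simp add: vec_eq_iff)
  qed
  moreover have "diag_mat \<sigma> *v x = - x" if "x \<in> coord_plane {i. \<sigma> i = - 1}" for x
  proof -
    have "(diag_mat \<sigma> *v x) $ i = - x $ i" for i
      using that by (cases "\<sigma> i = - 1") (auto simp: diag coord_plane_def)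
    then show ?thesis
      by (simp add: vec_eq_iff)
  qed
  ultimately show ?thesis
    by (simp add: reflection_negating_def)
qed

lemma coord_plane_in_Gr: "coord_plane J \<in> Gr (card J)"
proof -
  have "subspace (coord_plane J)"
    by (rule subspaceI) (auto simp: coord_plane_def)
  moreover have "dim (coord_plane J) = card J"
    using dim_substandard_cart[of J, where 'a = real]
    by (simp add: coord_plane_def dim_vec_eq)
  ultimately show ?thesis
    by (simp add: Gr_def)
qed

text \<open>With \<open>m = 2 k\<close> the left-hand side compares \<open>2 * d_Gr\<close> with \<open>pi * sqrt k\<close>; squaring gives the
  threshold \<open>m * pi\<^sup>2 / 8\<close>.\<close>

lemma sign_change_reduces_iff:
  fixes R :: "real^'n^'n"
  assumes m: "m = CARD('m::finite)" "even m"
    and W: "W \<in> Gr m" and R: "reflection_negating W R"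
    and \<sigma>: "\<And>i. \<sigma> i \<in> {1, - 1}" "sign_level \<sigma> = m"
  shows "d_SO (R ** diag_mat \<sigma>) (mat 1) < d_SO R (mat 1)
    \<longleftrightarrow> (d_Gr TYPE('m::finite) W (coord_plane {i. \<sigma> i = - 1}))\<^sup>2 < real m * pi\<^sup>2 / 8"
proof -
  let ?Z = "coord_plane {i. \<sigma> i = - 1}"
  let ?d = "d_Gr TYPE('m) W ?Z"
  obtain k where k: "m = 2 * k"
    using m(2) by blast
  have less_iff_sq: "x < y \<longleftrightarrow> x\<^sup>2 < y\<^sup>2" if "0 \<le> x" "0 \<le> y" for x y :: real
    using that by (meson pos2 power2_less_imp_less power_strict_mono)
  have "?Z \<in> Gr m"
    using coord_plane_in_Gr[of "{i. \<sigma> i = - 1}"] \<sigma>(2) by (simp add: sign_level_def)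
  then have "d_SO (R ** diag_mat \<sigma>) (mat 1) = 2 * ?d"
    using W m(1) d_SO_product_of_reflections[where 'm = 'm, of W ?Z] R
      reflection_negating_coord_plane[of \<sigma>, OF \<sigma>(1)] by blast
  moreover have "d_SO R (mat 1) = pi * sqrt (real k)"
    using W k R by (auto simp: Gr_def intro: d_SO_reflection)
  moreover have "0 \<le> ?d"
    by (simp add: d_Gr_def sum_nonneg)
  moreover have "0 \<le> pi * sqrt (real k)"
    by simp
  ultimately have "d_SO (R ** diag_mat \<sigma>) (mat 1) < d_SO R (mat 1)
      \<longleftrightarrow> (2 * ?d)\<^sup>2 < (pi * sqrt (real k))\<^sup>2"
    using less_iff_sq[of "2 * ?d" "pi * sqrt (real k)"] by (simp only: mult_nonneg_nonneg zero_le_numeral)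
  also have "\<dots> \<longleftrightarrow> 4 * ?d\<^sup>2 < pi\<^sup>2 * real k"
    by (simp only: power_mult_distrib) simp
  also have "\<dots> \<longleftrightarrow> ?d\<^sup>2 < real m * pi\<^sup>2 / 8"
    unfolding k by (auto simp: mult.commute)
  finally show ?thesis .
qed

theorem proposition4p11:
  fixes m p :: nat
  assumes "m = CARD('m::finite)" and "p = CARD('p::finite)"
    and "even m" and "0 < m" and "m \<le> p"
  shows "(\<forall>R :: real^'p^'p. involution R \<and> involution_level R = m \<longrightarrow>
            (\<exists>\<sigma>\<in>even_sign_changes. sign_level \<sigma> = m \<and>
               d_SO (R ** diag_mat \<sigma>) (mat 1) < d_SO R (mat 1)))
     \<longleftrightarrow>
         (\<forall>W \<in> (Gr m :: (real^'p) set set).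
            \<exists>J. card J = m \<and> (d_Gr TYPE('m) W (coord_plane J))\<^sup>2 < real m * pi\<^sup>2 / 8)"
  (is "?reducible \<longleftrightarrow> ?close")
proof
  assume red: ?reducible
  show ?close
  proof
    fix W :: "(real^'p) set" assume W: "W \<in> Gr m"
    then have W': "subspace W" "dim W = m"
      by (auto simp: Gr_def)
    then obtain R where R: "reflection_negating W R" "R \<in> SO"
      using assms(3) reflection_negating_exists by metis
    have eigenspace: "{x. R *v x = - x} = W"
      by (rule reflection_negating_eigenspace[OF W'(1) R(1)])
    have "R \<noteq> mat 1"
    proof
      assume "R = mat 1"
      then have "W = {0}"
        unfolding eigenspace[symmetric] by (auto simp: eq_neg_iff_add_eq_0 simp flip: scaleR_2)
      then show False
        using W'(2) assms(4) by simp
    qed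
    then have "involution R" "involution_level R = m"
      using R reflection_negating_square[OF R(1)] W'(2)
      by (auto simp: involution_def involution_level_def eigenspace)
    then obtain \<sigma> where \<sigma>: "\<sigma> \<in> even_sign_changes" "sign_level \<sigma> = m"
        "d_SO (R ** diag_mat \<sigma>) (mat 1) < d_SO R (mat 1)"
      using red by blast
    then have "(d_Gr TYPE('m) W (coord_plane {i. \<sigma> i = - 1}))\<^sup>2 < real m * pi\<^sup>2 / 8"
      using sign_change_reduces_iff[OF assms(1,3) W R(1)] by (simp add: even_sign_changes_def)
    then show "\<exists>J. card J = m \<and> (d_Gr TYPE('m) W (coord_plane J))\<^sup>2 < real m * pi\<^sup>2 / 8"
      using \<sigma>(2) by (auto simp: sign_level_def)
  qed
next
  assume close: ?close
  show ?reducible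
  proof (intro allI impI, elim conjE)
    fix R :: "real^'p^'p" assume R: "involution R" "involution_level R = m"
    define W where "W = {x. R *v x = - x}"
    have W: "W \<in> Gr m" "reflection_negating W R"
      using R subspace_negated involution_reflection_negating
      by (auto simp: W_def Gr_def involution_level_def)
    obtain J where J: "card J = m" "(d_Gr TYPE('m) W (coord_plane J))\<^sup>2 < real m * pi\<^sup>2 / 8"
      using close W(1) by blast
    define \<sigma> :: "'p \<Rightarrow> real" where "\<sigma> i = (if i \<in> J then - 1 else 1)" for i
    have neg: "{i. \<sigma> i = - 1} = J"
      by (auto simp: \<sigma>_def)
    have "\<sigma> \<in> even_sign_changes"
      using J(1) assms(3) by (simp add: even_sign_changes_def \<sigma>_def prod_sign)
    moreover have level: "sign_level \<sigma> = m"
      by (simp add: sign_level_def neg J(1))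
    moreover have "\<sigma> i \<in> {1, - 1}" for i
      by (simp add: \<sigma>_def)
    then have "d_SO (R ** diag_mat \<sigma>) (mat 1) < d_SO R (mat 1)"
      using sign_change_reduces_iff[OF assms(1,3) W _ level] J(2) by (simp add: neg)
    ultimately show "\<exists>\<sigma>\<in>even_sign_changes. sign_level \<sigma> = m \<and>
        d_SO (R ** diag_mat \<sigma>) (mat 1) < d_SO R (mat 1)"
      by blast
  qed
qed

end
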